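(* Let $(A,\mu,\alpha,B)$ be a quadratic Hom-Novikov superalgebra over a field $\mathbf{F}$ and let $HLie(A)=(A,[\cdot,\cdot],\alpha)$ be its sub-adjacent Hom-Lie superalgebra, where $[x,y]=xy-(-1)^{|x||y|}yx$. If $\alpha$ is an automorphism, then $[x,y]\in Z(A)$ for any $x,y\in HLie(A)$, where $Z(A)=\{x\in A\mid xy=yx=0\ \ \forall y\in A\}$. As a consequence, $HLie(A)$ is 2-step nilpotent, where a Hom-Lie superalgebra $A$ with lower central series $A^0=A$, $A^i=[A,A^{i-1}]$ $(i\geq 1)$ is called $i$-step nilpotent if $A^i=0$ and $A^{i-1}\neq 0$.
   Context: $\mathbf{F}$ is an arbitrary field. All graded spaces are $\mathbb{Z}_2$-graded, $A=A_{\bar 0}\oplus A_{\bar 1}$, $|x|$ is the degree of a homogeneous element $x$, and identities involving signs are required for all homogeneous elements (and operations given by signed formulas are extended bilinearly). A linear map $A\to A$ is even if it preserves degree; a bilinear map $A\times A\to A$ is even if degrees add. We write $\mu(x,y)=xy$. A Hom-Novikov superalgebra is a triple $(A,\mu,\alpha)$, where $A$ is a $\mathbb{Z}_2$-graded vector space, $\mu$ is an even bilinear product and $\alpha:A\to A$ is an even linear map, such that for all homogeneous $x,y,z$: (1) $\alpha(xy)=\alpha(x)\alpha(y)$; (2) $(xy)\alpha(z)-\alpha(x)(yz)=(-1)^{|x||y|}\big((yx)\alpha(z)-\alpha(y)(xz)\big)$; (3) $(xy)\alpha(z)=(-1)^{|y||z|}(xz)\alpha(y)$. A quadratic Hom-Novikov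 superalgebra is a quadruple $(A,\mu,\alpha,B)$, where $(A,\mu,\alpha)$ is a Hom-Novikov superalgebra and $B:A\times A\to\mathbf{F}$ is a bilinear form that is even ($B(A_{\bar 0},A_{\bar 1})=B(A_{\bar 1},A_{\bar 0})=0$), supersymmetric ($B(x,y)=(-1)^{|x||y|}B(y,x)$), non-degenerate ($B(x,y)=0$ for all $y$ implies $x=0$), and satisfies $B(\alpha(x),yz)=B(xy,\alpha(z))$ for all $x,y,z\in A$. A (multiplicative) Hom-Lie superalgebra is a triple $(A,[\cdot,\cdot],\alpha)$ with $A$ a $\mathbb{Z}_2$-graded vector space, $[\cdot,\cdot]$ an even bilinear map and $\alpha$ an even linear map such that, for homogeneous $x,y,z$: $\alpha([x,y])=[\alpha(x),\alpha(y)]$; $[x,y]=-(-1)^{|x||y|}[y,x]$; and $(-1)^{|x||z|}[\alpha(x),[y,z]]+(-1)^{|y||x|}[\alpha(y),[z,x]]+(-1)^{|z||y|}[\alpha(z),[x,y]]=0$. For a Hom-Novikov superalgebra $(A,\mu,\alpha)$, the bracket $[x,y]=xy-(-1)^{|x||y|}yx$ makes $(A,[\cdot,\cdot],\alpha)$ a Hom-Lie superalgebra, called the sub-adjacent Hom-Lie superalgebra $HLie(A)$. For subspaces, $[A,A^{i-1}]$ denotes the span of all $[x,y]$ with $x\in A$, $y\in A^{i-1}$.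
   Formalization: Exact 2-step nilpotency (A^2=0 and A^1≠0) is claimed only when the bracket is not identically zero, since it fails for A=F with the field product, α=id, B(x,y)=xy, where A^1=0; [x,y]∈Z(A) and A^2=0 are proved in all cases. *)

theory Defs
  imports Complex_Main "HOL-Library.Z2"
begin

text \<open>
  The degrees are the two elements of the type \<^typ>\<open>bit\<close> (the integers mod 2), so addition
  and multiplication of degrees are those of \<^typ>\<open>bit\<close>.  The sign below is
  $(-1)^{|x||y|}$ for $|x| = i$ and $|y| = j$; over a field of characteristic 2 it is always 1.
\<close>

definition koszul_sign :: "bit \<Rightarrow> bit \<Rightarrow> 'f::field"
  where "koszul_sign i j = (if i * j = 1 then - 1 else 1)"

locale super_vector_space = vector_space scale
  for scale :: "'f::field \<Rightarrow> 'a::ab_group_add \<Rightarrow> 'a" (infixr "*s" 75) +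
  fixes V :: "bit \<Rightarrow> 'a set"
  assumes subspace_V: "subspace (V i)"
    and V_disjoint: "V 0 \<inter> V 1 = {0}"
    and V_sum: "\<exists>a\<in>V 0. \<exists>b\<in>V 1. x = a + b"
begin

text \<open>The component of degree \<open>i\<close>; note that \<open>i + 1\<close> is the other degree.\<close>

definition component :: "bit \<Rightarrow> 'a \<Rightarrow> 'a"
  where "component i x = (THE a. a \<in> V i \<and> x - a \<in> V (i + 1))"

lemma V_inter: "x \<in> V i \<Longrightarrow> x \<in> V (i + 1) \<Longrightarrow> x = 0"
  using V_disjoint by (cases i) auto

lemma component_unique:
  assumes "a \<in> V i" and "x - a \<in> V (i + 1)"
  shows "component i x = a"
  unfolding component_def
proof (rule the_equality)
  fix b
  assume b: "b \<in> V i \<and> x - b \<in> V (i + 1)"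
  have "b - a \<in> V i"
    using b assms subspace_diff[OF subspace_V] by blast
  moreover have "b - a = (x - a) - (x - b)"
    by simp
  then have "b - a \<in> V (i + 1)"
    using b assms subspace_diff[OF subspace_V] by metis
  ultimately show "b = a"
    using V_inter by fastforce
qed (use assms in blast)

lemma component_homogeneous:
  assumes "x \<in> V i"
  shows "component j x = (if j = i then x else 0)"
proof (cases "j = i")
  case True
  then show ?thesis
    using assms subspace_0[OF subspace_V] by (simp add: component_unique)
next
  case False
  then have "i = j + 1"
    by (cases i; cases j) auto
  then show ?thesis
    using False assms subspace_0[OF subspace_V] by (simp add: component_unique)
qed

end

locale hom_superalgebra = super_vector_space scale V
  for scale :: "'f::field \<Rightarrow> 'a::ab_group_add \<Rightarrow> 'a" (infixr "*s" 75)
    and V :: "bit \<Rightarrow> 'a set" +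
  fixes mu :: "'a \<Rightarrow> 'a \<Rightarrow> 'a" (infixl "\<cdot>" 70)
    and \<alpha> :: "'a \<Rightarrow> 'a"
  assumes mu_linear_right: "Vector_Spaces.linear scale scale (\<lambda>y. x \<cdot> y)"
    and mu_linear_left: "Vector_Spaces.linear scale scale (\<lambda>x. x \<cdot> y)"
    and mu_even: "x \<in> V i \<Longrightarrow> y \<in> V j \<Longrightarrow> x \<cdot> y \<in> V (i + j)"
    and \<alpha>_linear: "Vector_Spaces.linear scale scale \<alpha>"
    and \<alpha>_even: "x \<in> V i \<Longrightarrow> \<alpha> x \<in> V i"
    and \<alpha>_mult: "\<alpha> (x \<cdot> y) = \<alpha> x \<cdot> \<alpha> y"
begin

definition center :: "'a set"
  where "center = {x. \<forall>y. x \<cdot> y = 0 \<and> y \<cdot> x = 0}"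

end

locale hom_lie_superalgebra = hom_superalgebra scale V bracket \<alpha>
  for scale :: "'f::field \<Rightarrow> 'a::ab_group_add \<Rightarrow> 'a" (infixr "*s" 75)
    and V :: "bit \<Rightarrow> 'a set"
    and bracket :: "'a \<Rightarrow> 'a \<Rightarrow> 'a"
    and \<alpha> :: "'a \<Rightarrow> 'a" +
  assumes super_skew:
      "x \<in> V i \<Longrightarrow> y \<in> V j \<Longrightarrow> bracket x y = - (koszul_sign i j *s bracket y x)"
    and super_hom_jacobi:
      "x \<in> V i \<Longrightarrow> y \<in> V j \<Longrightarrow> z \<in> V k \<Longrightarrow>
         koszul_sign i k *s bracket (\<alpha> x) (bracket y z)
       + koszul_sign j i *s bracket (\<alpha> y) (bracket z x)
       + koszul_sign k j *s bracket (\<alpha> z) (bracket x y) = 0"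
begin

primrec lower_central :: "nat \<Rightarrow> 'a set"
  where
    "lower_central 0 = UNIV"
  | "lower_central (Suc n) = span {bracket x y | x y. y \<in> lower_central n}"

definition step_nilpotent :: "nat \<Rightarrow> bool"
  where "step_nilpotent i \<longleftrightarrow>
    i \<ge> 1 \<and> lower_central i = {0} \<and> lower_central (i - 1) \<noteq> {0}"

end

locale hom_novikov_superalgebra = hom_superalgebra scale V mu \<alpha>
  for scale :: "'f::field \<Rightarrow> 'a::ab_group_add \<Rightarrow> 'a" (infixr "*s" 75)
    and V :: "bit \<Rightarrow> 'a set"
    and mu :: "'a \<Rightarrow> 'a \<Rightarrow> 'a" (infixl "\<cdot>" 70)
    and \<alpha> :: "'a \<Rightarrow> 'a" +
  assumes left_symmetry:
      "x \<in> V i \<Longrightarrow> y \<in> V j \<Longrightarrow> z \<in> V k \<Longrightarrow>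
        (x \<cdot> y) \<cdot> \<alpha> z - \<alpha> x \<cdot> (y \<cdot> z)
          = koszul_sign i j *s ((y \<cdot> x) \<cdot> \<alpha> z - \<alpha> y \<cdot> (x \<cdot> z))"
    and right_commutativity:
      "x \<in> V i \<Longrightarrow> y \<in> V j \<Longrightarrow> z \<in> V k \<Longrightarrow>
        (x \<cdot> y) \<cdot> \<alpha> z = koszul_sign j k *s ((x \<cdot> z) \<cdot> \<alpha> y)"
begin

text \<open>
  The bilinear extension of $[x,y] = xy - (-1)^{|x||y|} yx$ from homogeneous to arbitrary
  elements; the lemma \<open>bracket_homogeneous\<close> recovers the formula.
\<close>

definition bracket :: "'a \<Rightarrow> 'a \<Rightarrow> 'a"
  where "bracket x y = (\<Sum>i\<in>{0, 1}. \<Sum>j\<in>{0, 1}.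
    component i x \<cdot> component j y - koszul_sign i j *s (component j y \<cdot> component i x))"

end

locale quadratic_hom_novikov_superalgebra = hom_novikov_superalgebra scale V mu \<alpha>
  for scale :: "'f::field \<Rightarrow> 'a::ab_group_add \<Rightarrow> 'a" (infixr "*s" 75)
    and V :: "bit \<Rightarrow> 'a set"
    and mu :: "'a \<Rightarrow> 'a \<Rightarrow> 'a" (infixl "\<cdot>" 70)
    and \<alpha> :: "'a \<Rightarrow> 'a" +
  fixes B :: "'a \<Rightarrow> 'a \<Rightarrow> 'f"
  assumes B_linear_right: "Vector_Spaces.linear scale (*) (\<lambda>y. B x y)"
    and B_linear_left: "Vector_Spaces.linear scale (*) (\<lambda>x. B x y)"
    and B_even: "x \<in> V i \<Longrightarrow> y \<in> V j \<Longrightarrow> i \<noteq> j \<Longrightarrow> B x y = 0"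
    and B_supersymmetric: "x \<in> V i \<Longrightarrow> y \<in> V j \<Longrightarrow> B x y = koszul_sign i j * B y x"
    and B_nondegenerate: "(\<And>y. B x y = 0) \<Longrightarrow> x = 0"
    and B_invariant: "B (\<alpha> x) (y \<cdot> z) = B (x \<cdot> y) (\<alpha> z)"

context super_vector_space
begin

lemma component_in: "component i x \<in> V i"
  and component_sum: "component 0 x + component 1 x = x"
proof -
  obtain a b where ab: "a \<in> V 0" "b \<in> V 1" "x = a + b"
    using V_sum by blast
  have "component 0 x = a" "component 1 x = b"
    using ab by (auto intro!: component_unique)
  then show "component i x \<in> V i" "component 0 x + component 1 x = x"
    using ab by (cases i; simp)+
qed

lemma component_eqI:
  assumes "a \<in> V 0" "b \<in> V 1" "x = a + b"
  shows "component 0 x = a" "component 1 x = b"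
  using assms by (auto intro!: component_unique)

lemma component_add: "component i (x + y) = component i x + component i y"
proof (rule component_unique)
  have eq: "x - component i x = component (i + 1) x" for x
    using component_sum[of x] by (cases i) (auto simp: algebra_simps)
  have "x + y - (component i x + component i y) = (x - component i x) + (y - component i y)"
    by simp
  then show "x + y - (component i x + component i y) \<in> V (i + 1)"
    by (simp only: eq) (intro subspace_add[OF subspace_V] component_in)
qed (intro subspace_add[OF subspace_V] component_in)

lemma component_scale: "component i (c *s x) = c *s component i x"
proof (rule component_unique)
  have eq: "x - component i x = component (i + 1) x" for x
    using component_sum[of x] by (cases i) (auto simp: algebra_simps)
  have "c *s x - c *s component i x = c *s (x - component i x)"
    by (simp add: scale_right_diff_distrib)
  then show "c *s x - c *s component i x \<in> V (i + 1)"
    by (simp only: eq) (intro subspace_scale[OF subspace_V] component_in)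
qed (intro subspace_scale[OF subspace_V] component_in)

end

context hom_superalgebra
begin

lemma mu_simps:
  "(x + y) \<cdot> z = x \<cdot> z + y \<cdot> z" "z \<cdot> (x + y) = z \<cdot> x + z \<cdot> y"
  "(x - y) \<cdot> z = x \<cdot> z - y \<cdot> z" "z \<cdot> (x - y) = z \<cdot> x - z \<cdot> y"
  "(- x) \<cdot> z = - (x \<cdot> z)" "z \<cdot> (- x) = - (z \<cdot> x)"
  "(c *s x) \<cdot> z = c *s (x \<cdot> z)" "z \<cdot> (c *s x) = c *s (z \<cdot> x)"
  "0 \<cdot> z = 0" "z \<cdot> 0 = 0"
proof -
  interpret R: Vector_Spaces.linear scale scale "\<lambda>y. z \<cdot> y" by (rule mu_linear_right)
  interpret L: Vector_Spaces.linear scale scale "\<lambda>x. x \<cdot> z" by (rule mu_linear_left)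
  show "(x + y) \<cdot> z = x \<cdot> z + y \<cdot> z" "z \<cdot> (x + y) = z \<cdot> x + z \<cdot> y"
    "(x - y) \<cdot> z = x \<cdot> z - y \<cdot> z" "z \<cdot> (x - y) = z \<cdot> x - z \<cdot> y"
    "(- x) \<cdot> z = - (x \<cdot> z)" "z \<cdot> (- x) = - (z \<cdot> x)"
    "(c *s x) \<cdot> z = c *s (x \<cdot> z)" "z \<cdot> (c *s x) = c *s (z \<cdot> x)"
    "0 \<cdot> z = 0" "z \<cdot> 0 = 0"
    by (fact R.add L.add R.diff L.diff R.neg L.neg R.scale L.scale R.zero L.zero)+
qed

lemma \<alpha>_simps: "\<alpha> (x + y) = \<alpha> x + \<alpha> y" "\<alpha> (x - y) = \<alpha> x - \<alpha> y" "\<alpha> (c *s x) = c *s \<alpha> x"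
proof -
  interpret Vector_Spaces.linear scale scale \<alpha> by (rule \<alpha>_linear)
  show "\<alpha> (x + y) = \<alpha> x + \<alpha> y" "\<alpha> (x - y) = \<alpha> x - \<alpha> y" "\<alpha> (c *s x) = c *s \<alpha> x"
    by (fact add diff scale)+
qed

lemma component_\<alpha>: "component i (\<alpha> x) = \<alpha> (component i x)"
proof -
  have "\<alpha> x = \<alpha> (component 0 x) + \<alpha> (component 1 x)"
    by (simp only: \<alpha>_simps(1)[symmetric] component_sum)
  from component_eqI[OF \<alpha>_even[OF component_in] \<alpha>_even[OF component_in] this]
  show ?thesis
    by (cases i) simp_all
qed

end

context hom_novikov_superalgebra
begin

lemma bracket_homogeneous:
  "x \<in> V i \<Longrightarrow> y \<in> V j \<Longrightarrow> bracket x y = x \<cdot> y - koszul_sign i j *s (y \<cdot> x)"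
  by (cases i; cases j) (auto simp: bracket_def component_homogeneous mu_simps)

lemma bracket_even:
  assumes "x \<in> V i" and "y \<in> V j"
  shows "bracket x y \<in> V (i + j)"
proof -
  have "y \<cdot> x \<in> V (i + j)"
    using mu_even[OF assms(2,1)] by (simp only: add.commute)
  then show ?thesis
    unfolding bracket_homogeneous[OF assms]
    by (intro subspace_diff subspace_scale subspace_V mu_even[OF assms])
qed

lemma bracket_skew:
  "x \<in> V i \<Longrightarrow> y \<in> V j \<Longrightarrow> bracket x y = - (koszul_sign i j *s bracket y x)"
  by (cases i; cases j) (simp_all add: bracket_homogeneous koszul_sign_def)

lemma bracket_hom_jacobi:
  assumes "x \<in> V i" "y \<in> V j" "z \<in> V k"
  shows "koszul_sign i k *s bracket (\<alpha> x) (bracket y z)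
       + koszul_sign j i *s bracket (\<alpha> y) (bracket z x)
       + koszul_sign k j *s bracket (\<alpha> z) (bracket x y) = 0" (is "?J = 0")
proof -
  define D where "D i j x y z = ((x \<cdot> y) \<cdot> \<alpha> z - \<alpha> x \<cdot> (y \<cdot> z))
      - koszul_sign i j *s ((y \<cdot> x) \<cdot> \<alpha> z - \<alpha> y \<cdot> (x \<cdot> z))" for i j x y z
  have D0: "D i j x y z = 0" "D j k y z x = 0" "D k i z x y = 0"
    unfolding D_def right_minus_eq
    by (fact left_symmetry[OF assms] left_symmetry[OF assms(2,3,1)] left_symmetry[OF assms(3,1,2)])+
  have e: "bracket (\<alpha> x) (bracket y z)
      = \<alpha> x \<cdot> bracket y z - koszul_sign i (j + k) *s (bracket y z \<cdot> \<alpha> x)"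
    "bracket (\<alpha> y) (bracket z x)
      = \<alpha> y \<cdot> bracket z x - koszul_sign j (k + i) *s (bracket z x \<cdot> \<alpha> y)"
    "bracket (\<alpha> z) (bracket x y)
      = \<alpha> z \<cdot> bracket x y - koszul_sign k (i + j) *s (bracket x y \<cdot> \<alpha> z)"
    by (intro bracket_homogeneous \<alpha>_even bracket_even assms)+
  have s: "koszul_sign 0 l = (1::'f)" "koszul_sign l 0 = (1::'f)"
    "koszul_sign 1 1 = (- 1::'f)"
    "(0::bit) + 0 = 0" "(0::bit) + 1 = 1" "(1::bit) + 0 = 1" "(1::bit) + 1 = 0" for l
    by (simp_all add: koszul_sign_def)
  have "?J = - (koszul_sign i k *s D i j x y z + koszul_sign j i *s D j k y z x
        + koszul_sign k j *s D k i z x y)"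
    unfolding e unfolding bracket_homogeneous[OF assms(1,2)] bracket_homogeneous[OF assms(2,3)]
      bracket_homogeneous[OF assms(3,1)] D_def
    by (cases i; cases j; cases k; simp only: s mu_simps scale_one scale_minus_left
        scale_right_distrib diff_conv_add_uminus minus_add_distrib minus_minus add_ac
        scale_minus_right)
  then show ?thesis
    by (simp add: D0)
qed

lemma bracket_linear_left: "Vector_Spaces.linear scale scale (\<lambda>x. bracket x y)"
  by unfold_locales
    (simp_all add: bracket_def component_add component_scale mu_simps scale_right_distrib
      scale_right_diff_distrib mult.commute)

lemma bracket_linear_right: "Vector_Spaces.linear scale scale (\<lambda>y. bracket x y)"
  by unfold_locales
    (simp_all add: bracket_def component_add component_scale mu_simps scale_right_distrib
      scale_right_diff_distrib mult.commute)

lemma bracket_\<alpha>: "\<alpha> (bracket x y) = bracket (\<alpha> x) (\<alpha> y)"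
  by (simp add: bracket_def component_\<alpha> \<alpha>_simps \<alpha>_mult)

sublocale HLie: hom_lie_superalgebra scale V bracket \<alpha>
proof (intro hom_lie_superalgebra.intro hom_superalgebra.intro hom_superalgebra_axioms.intro
    hom_lie_superalgebra_axioms.intro)
qed (fact super_vector_space_axioms bracket_linear_right bracket_linear_left bracket_even
    \<alpha>_linear \<alpha>_even bracket_\<alpha> bracket_skew bracket_hom_jacobi)+

end

end

theory Submission
  imports Defs
begin

text \<open>
  Moving factors across the form twice turns right commutativity into
  $\alpha(y)(zw) = (-1)^{|y||z|}\alpha(z)(yw)$.  Left symmetry then reads $[y,z]\,\alpha(w) = 0$, so
  commutators annihilate $A$ from the left because $\alpha$ is onto; invariance of the form moves
  this annihilation to the right-hand side.
\<close>

context super_vector_space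
begin

text \<open>Every element is the sum of its two components, so an additive property needs checking
  only where the sign rules apply.\<close>

lemma homogeneous_induct [case_names homogeneous add]:
  assumes "\<And>i x. x \<in> V i \<Longrightarrow> P x"
    and "\<And>x y. P x \<Longrightarrow> P y \<Longrightarrow> P (x + y)"
  shows "P x"
  using assms component_in component_sum[of x] by metis

end

context hom_superalgebra
begin

lemma subspace_center: "subspace center"
  by (rule subspaceI) (simp_all add: center_def mu_simps)

text \<open>For homogeneous \<open>y\<close>, the products of the two components of \<open>c\<close>
  with \<open>y\<close> have opposite degrees, so their sum vanishes only if both do. This is needed
  because \<open>bracket\<close> is defined through components.\<close>

lemma component_in_center:
  assumes "c \<in> center"
  shows "component i c \<in> center"
proof -
  have split: "a = 0 \<and> b = 0" if "a \<in> V (0 + j)" "b \<in> V (1 + j)" "a + b = 0" for a b j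
  proof -
    have "a = - b"
      using that(3) by (simp add: eq_neg_iff_add_eq_0)
    then have "a \<in> V (j + 1)"
      using that(2) subspace_neg[OF subspace_V] by (simp add: add.commute)
    then have "a = 0"
      using that(1) V_inter by simp
    then show ?thesis
      using that(3) by simp
  qed
  have "component i c \<cdot> y = 0 \<and> y \<cdot> component i c = 0" for y
  proof (induction y rule: homogeneous_induct)
    case (homogeneous j y)
    have "component 0 c \<cdot> y + component 1 c \<cdot> y = 0" "y \<cdot> component 0 c + y \<cdot> component 1 c = 0"
      using assms by (simp_all add: mu_simps(1,2)[symmetric] component_sum center_def)
    moreover have "component k c \<cdot> y \<in> V (k + j)" for k
      by (rule mu_even[OF component_in homogeneous])
    moreover have "y \<cdot> component k c \<in> V (k + j)" for k
      using mu_even[OF homogeneous component_in] by (simp only: add.commute[of k j])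
    ultimately show ?case
      using split by (cases i) blast+
  qed (simp add: mu_simps)
  then show ?thesis
    by (simp add: center_def)
qed

end

context hom_novikov_superalgebra
begin

lemma bracket_components:
  "bracket x y = (\<Sum>i\<in>{0, 1}. \<Sum>j\<in>{0, 1}. bracket (component i x) (component j y))"
  unfolding bracket_def[of x y]
  by (intro sum.cong refl bracket_homogeneous[symmetric] component_in)

lemma bracket_center:
  assumes "c \<in> center"
  shows "bracket x c = 0"
  using component_in_center[OF assms] by (simp add: bracket_def center_def)

end

context quadratic_hom_novikov_superalgebra
begin

text \<open>Non-degeneracy is assumed in the first argument; homogeneity of \<open>u\<close> lets
  supersymmetry exchange the arguments against each homogeneous \<open>y\<close>.\<close>

lemma B_nondegenerate_right:
  assumes "u \<in> V i" and "\<And>x. B x u = 0"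
  shows "u = 0"
proof (rule B_nondegenerate)
  interpret L: Vector_Spaces.linear scale "(*)" "\<lambda>v. B u v" by (rule B_linear_right)
  show "B u y = 0" for y
  proof (induction y rule: homogeneous_induct)
    case (homogeneous j y)
    then show ?case
      using B_supersymmetric[OF assms(1) homogeneous] assms(2) by simp
  qed (simp add: L.add)
qed

text \<open>Between two uses of invariance, multiplicativity rewrites
  \<open>\<alpha> (x \<cdot> y)\<close> as a product and
  \<open>\<alpha> z \<cdot> \<alpha> w\<close> as an image under \<open>\<alpha>\<close>.\<close>

lemma B_twice_invariant: "B ((x \<cdot> y) \<cdot> \<alpha> z) (\<alpha> (\<alpha> w)) = B (\<alpha> (\<alpha> x)) (\<alpha> y \<cdot> (z \<cdot> w))"
  by (metis B_invariant \<alpha>_mult)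

lemma left_supercommutativity:
  assumes "surj \<alpha>" and y: "y \<in> V j" and z: "z \<in> V k" and w: "w \<in> V l"
  shows "\<alpha> y \<cdot> (z \<cdot> w) = koszul_sign j k *s (\<alpha> z \<cdot> (y \<cdot> w))"
proof -
  let ?u = "\<alpha> y \<cdot> (z \<cdot> w) - koszul_sign j k *s (\<alpha> z \<cdot> (y \<cdot> w))"
  \<comment> \<open>Both terms must have the same degree, so that \<open>?u\<close> is homogeneous
    and non-degeneracy in the second argument applies.\<close>
  have "\<alpha> z \<cdot> (y \<cdot> w) \<in> V (j + (k + l))"
    using mu_even[OF \<alpha>_even[OF z] mu_even[OF y w]] by (simp only: add.left_commute[of j k])
  then have "?u \<in> V (j + (k + l))"
    by (intro subspace_diff[OF subspace_V] subspace_scale[OF subspace_V]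
        mu_even[OF \<alpha>_even[OF y] mu_even[OF z w]])
  moreover have "B x ?u = 0" for x
  proof -
    \<comment> \<open>Invariance is used twice, so the test vector has to be a double image under
      \<open>\<alpha>\<close>.\<close>
    obtain x' where x': "x = \<alpha> (\<alpha> x')"
      using comp_surj[OF assms(1) assms(1)] by (auto elim: surjE)
    interpret R: Vector_Spaces.linear scale "(*)" "\<lambda>v. B v t" for t by (rule B_linear_left)
    interpret L: Vector_Spaces.linear scale "(*)" "\<lambda>v. B t v" for t by (rule B_linear_right)
    have "B (\<alpha> (\<alpha> x')) (\<alpha> y \<cdot> (z \<cdot> w)) = koszul_sign j k * B (\<alpha> (\<alpha> x')) (\<alpha> z \<cdot> (y \<cdot> w))"
    proof (induction x' rule: homogeneous_induct)
      case (homogeneous i x)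
      show ?case
        \<comment> \<open>Both sides now pair with the same vector
          \<open>\<alpha> (\<alpha> w)\<close>, and their first arguments differ by right
          commutativity.\<close>
        unfolding B_twice_invariant[symmetric]
        by (simp add: right_commutativity[OF homogeneous y z] R.scale)
    qed (simp add: \<alpha>_simps R.add distrib_left)
    then show ?thesis
      by (simp add: x' L.diff L.scale)
  qed
  ultimately have "?u = 0"
    by (rule B_nondegenerate_right)
  then show ?thesis
    by simp
qed

lemma bracket_mult_eq_0:
  assumes "surj \<alpha>"
  shows "bracket x y \<cdot> w = 0"
proof -
  have homogeneous: "bracket a b \<cdot> w = 0" if a: "a \<in> V i" and b: "b \<in> V j" for a b i j
  proof -
    \<comment> \<open>Left symmetry only speaks of right factors of the form
      \<open>\<alpha> v\<close>.\<close>
    obtain v where v: "w = \<alpha> v"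
      using assms by (rule surjE)
    have "bracket a b \<cdot> \<alpha> v = 0"
    proof (induction v rule: homogeneous_induct)
      case (homogeneous k v)
      have "bracket a b \<cdot> \<alpha> v = (a \<cdot> b) \<cdot> \<alpha> v - koszul_sign i j *s ((b \<cdot> a) \<cdot> \<alpha> v)"
        by (simp add: bracket_homogeneous[OF a b] mu_simps)
      \<comment> \<open>Left symmetry with the terms regrouped: both left-bracketed products on one
        side, both right-bracketed ones on the other.\<close>
      also have "\<dots> = \<alpha> a \<cdot> (b \<cdot> v) - koszul_sign i j *s (\<alpha> b \<cdot> (a \<cdot> v))"
        using left_symmetry[OF a b homogeneous]
        by (simp add: scale_right_diff_distrib algebra_simps)
      also have "\<dots> = 0"
        by (simp add: left_supercommutativity[OF assms a b homogeneous])
      finally show ?case .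
    qed (simp add: \<alpha>_simps mu_simps)
    then show ?thesis
      by (simp add: v)
  qed
  show ?thesis
    unfolding bracket_components[of x y]
    by (simp add: mu_simps homogeneous[OF component_in component_in])
qed

lemma bracket_in_center:
  assumes "surj \<alpha>"
  shows "bracket x y \<in> center"
proof -
  interpret L: Vector_Spaces.linear scale "(*)" "\<lambda>v. B t v" for t by (rule B_linear_right)
  have "z \<cdot> bracket x y = 0" for z
  proof (rule B_nondegenerate)
    fix t
    obtain w where "t = \<alpha> w"
      using assms by (rule surjE)
    \<comment> \<open>Invariance gives \<open>B (\<alpha> z) (bracket x y \<cdot> w)\<close>, where
      the bracket stands on the left and annihilates \<open>w\<close>.\<close>
    then show "B (z \<cdot> bracket x y) t = 0"
      by (simp add: B_invariant[symmetric] bracket_mult_eq_0[OF assms] L.zero)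
  qed
  then show ?thesis
    by (simp add: center_def bracket_mult_eq_0[OF assms])
qed

lemma lower_central_2:
  assumes "surj \<alpha>"
  shows "HLie.lower_central 2 = {0}"
proof -
  have "HLie.lower_central 1 \<subseteq> center"
    unfolding One_nat_def HLie.lower_central.simps
    by (rule span_minimal) (use subspace_center bracket_in_center[OF assms] in auto)
  then have "{bracket x y | x y. y \<in> HLie.lower_central 1} \<subseteq> {0}"
    using bracket_center by blast
  then have "HLie.lower_central (Suc 1) = {0}"
    unfolding HLie.lower_central.simps
    by (intro subset_antisym span_minimal subspace_single_0) (simp_all add: span_zero)
  then show ?thesis
    by (simp only: Suc_1)
qed

text \<open>A nonzero bracket keeps the first term of the series nonzero; if all brackets vanish,
  that term is already zero and the step is not exactly 2.\<close>

lemma step_nilpotent_2: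
  assumes "surj \<alpha>" and "bracket x y \<noteq> 0"
  shows "HLie.step_nilpotent 2"
proof -
  have "bracket x y \<in> HLie.lower_central 1"
    by (auto intro: span_base)
  then show ?thesis
    using assms lower_central_2 by (auto simp add: HLie.step_nilpotent_def)
qed

end

theorem theorem3p10:
  fixes scale :: "'f::field \<Rightarrow> 'a::ab_group_add \<Rightarrow> 'a"
    and V :: "bit \<Rightarrow> 'a set"
    and mu :: "'a \<Rightarrow> 'a \<Rightarrow> 'a"
    and \<alpha> :: "'a \<Rightarrow> 'a"
    and B :: "'a \<Rightarrow> 'a \<Rightarrow> 'f"
  assumes "quadratic_hom_novikov_superalgebra scale V mu \<alpha> B"
    and "bij \<alpha>"
  shows "(\<forall>x y. hom_novikov_superalgebra.bracket scale V mu x y \<in> hom_superalgebra.center mu) \<and>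
    hom_lie_superalgebra.lower_central scale
      (hom_novikov_superalgebra.bracket scale V mu) 2 = {0} \<and>
    ((\<exists>x y. hom_novikov_superalgebra.bracket scale V mu x y \<noteq> 0) \<longrightarrow>
      hom_lie_superalgebra.step_nilpotent scale
        (hom_novikov_superalgebra.bracket scale V mu) 2)"
proof -
  interpret quadratic_hom_novikov_superalgebra scale V mu \<alpha> B
    by (rule assms(1))
  note surj = bij_is_surj[OF assms(2)]
  show ?thesis
    using bracket_in_center[OF surj] lower_central_2[OF surj] step_nilpotent_2[OF surj] by auto
qed

end
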